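(* Let $(X,S)$ be a thin coherent configuration, with associated monoid $(S,\nabla,e)$ in $\mathbf{Mat}_{\mathbb R_0^+}$. Then the monoid $(R(S),R(\nabla),R(e))$ in $\mathbf{Rel}$ is a groupoid; that is, the relation $R(\nabla)\colon S\times S\to S$ is a partial binary operation on $S$ which is the composition of a groupoid whose set of morphisms is $S$ and whose set of identity morphisms is the subset of $S$ selected by $R(e)$.
   Context: $\mathbf{Mat}_{\mathbb R_0^+}$ is the category whose objects are finite sets and whose morphisms $X\to Y$ are non-negative real matrices with entries $f_x^y$, composed by matrix multiplication, monoidal via cartesian product of sets and Kronecker product of matrices, with unit object $I=\{*\}$. The functor $R\colon \mathbf{Mat}_{\mathbb R_0^+}\to\mathbf{Rel}$ to sets and relations is the identity on objects and sends $f\colon A\to B$ to the relation $\{(a,b): f_a^b>0\}$; it is strictly monoidal. A coherent configuration $(X,S)$ is a finite set $X$ with a partition $S$ of $X\times X$ such that: if $p\in S$ contains some $(x,x)$ then $p\subseteq\mathrm{id}_X$; for $a,b,c\in S$ the number $\nabla_{ab}^c$ of $z\in X$ with $(x,z)\in a$, $(z,y)\in b$ is the same for all $(x,y)\in c$; and $c\in S$ implies $c^{-1}=\{(y,x):(x,y)\in c\}\in S$. The valency $\|a\|$ of $a\in S$ is the number of $y\in X$ with $(x,y)\in a$, for any $x$ for which at least one such $y$ exists. $(X,S)$ is thin if $\|a\|=1$ for all $a\in S$. The associated monoid is $(S,\nabla,e)$ with $\nabla\colon S\otimes S\to S$ the matrix of the $\nabla_{ab}^c$ and $e\colon I\to S$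 with $e_*^a=1$ if $a\subseteq\mathrm{id}_X$ and $0$ otherwise. A groupoid is a category in which every morphism is invertible. A small groupoid is regarded as a monoid in $\mathbf{Rel}$ on its set of morphisms $G_1$: the multiplication relation $G_1\times G_1\to G_1$ is the partial operation of composition, and the unit relation $\{*\}\to G_1$ selects the set of identity morphisms. *)

theory Defs
  imports Complex_Main "HOL-Library.Disjoint_Sets"
begin

section \<open>Coherent configurations\<close>

locale coherent_configuration =
  fixes X :: "'x set" and S :: "'x rel set"
  assumes finite_points: "finite X"
    and partition: "partition_on (X \<times> X) S"
    and diagonal: "\<lbrakk>p \<in> S; (x, x) \<in> p\<rbrakk> \<Longrightarrow> p \<subseteq> Id_on X"
    and coherent: "\<lbrakk>a \<in> S; b \<in> S; c \<in> S; (x, y) \<in> c; (x', y') \<in> c\<rbrakk> \<Longrightarrow>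
      card {z \<in> X. (x, z) \<in> a \<and> (z, y) \<in> b} = card {z \<in> X. (x', z) \<in> a \<and> (z, y') \<in> b}"
    and converse_closed: "c \<in> S \<Longrightarrow> c\<inverse> \<in> S"

text \<open>The next two numbers are only meaningful for members of the partition of a coherent
  configuration, where independence of the chosen points is proved below.\<close>

definition valency :: "'x rel \<Rightarrow> nat" where
  "valency a = (THE n. \<forall>x \<in> Domain a. card (a `` {x}) = n)"

definition nabla_number :: "'x set \<Rightarrow> 'x rel \<Rightarrow> 'x rel \<Rightarrow> 'x rel \<Rightarrow> nat" where
  "nabla_number X a b c =
    (THE n. \<forall>(x, y) \<in> c. card {z \<in> X. (x, z) \<in> a \<and> (z, y) \<in> b} = n)"

definition thin :: "'x rel set \<Rightarrow> bool" where
  "thin S \<longleftrightarrow> (\<forall>a \<in> S. valency a = 1)"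

context coherent_configuration
begin

lemma nabla_number_eq:
  assumes "a \<in> S" "b \<in> S" "c \<in> S" "(x, y) \<in> c"
  shows "nabla_number X a b c = card {z \<in> X. (x, z) \<in> a \<and> (z, y) \<in> b}"
  unfolding nabla_number_def
proof (rule the_equality)
  show "\<forall>(u, v) \<in> c. card {z \<in> X. (u, z) \<in> a \<and> (z, v) \<in> b}
      = card {z \<in> X. (x, z) \<in> a \<and> (z, y) \<in> b}"
    using coherent[OF assms(1-3)] assms(4) by blast
next
  fix n
  assume "\<forall>(u, v) \<in> c. card {z \<in> X. (u, z) \<in> a \<and> (z, v) \<in> b} = n"
  then show "n = card {z \<in> X. (x, z) \<in> a \<and> (z, y) \<in> b}"
    using assms(4) by auto
qed

lemma subset_points:
  assumes "a \<in> S"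
  shows "a \<subseteq> X \<times> X"
  using partition assms by (auto simp: partition_on_def)

lemma valency_eq:
  assumes a: "a \<in> S" and x: "x \<in> Domain a"
  shows "valency a = card (a `` {x})"
  unfolding valency_def
proof (rule the_equality)
  have aX: "a \<subseteq> X \<times> X"
    using subset_points[OF a] .
  obtain y where xy: "(x, y) \<in> a"
    using x by blast
  have "(x, x) \<in> X \<times> X"
    using xy aX by blast
  then obtain p where p: "p \<in> S" "(x, x) \<in> p"
    using partition by (auto simp: partition_on_def)
  have pId: "p \<subseteq> Id_on X"
    using diagonal[OF p] .
  show "\<forall>x' \<in> Domain a. card (a `` {x'}) = card (a `` {x})"
  proof
    fix x' assume "x' \<in> Domain a"
    then obtain y' where xy': "(x', y') \<in> a"
      by blast
    have "x \<in> {z \<in> X. (x, z) \<in> p \<and> (z, y) \<in> a}"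
      using xy aX p by blast
    moreover have "finite {z \<in> X. (x, z) \<in> p \<and> (z, y) \<in> a}"
      using finite_points by simp
    ultimately have "card {z \<in> X. (x, z) \<in> p \<and> (z, y) \<in> a} \<noteq> 0"
      by (metis card_0_eq empty_iff)
    then have "card {z \<in> X. (x', z) \<in> p \<and> (z, y') \<in> a} \<noteq> 0"
      using coherent[OF p(1) a a xy xy'] by simp
    then have "{z \<in> X. (x', z) \<in> p \<and> (z, y') \<in> a} \<noteq> {}"
      by force
    then have x'p: "(x', x') \<in> p"
      using pId by auto
    have img: "{z \<in> X. (u, z) \<in> a \<and> (z, u) \<in> a\<inverse>} = a `` {u}" for u
      using aX by blast
    show "card (a `` {x'}) = card (a `` {x})"
      using coherent[OF a converse_closed[OF a] p(1) x'p p(2)] by (simp only: img)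
  qed
next
  fix n
  assume "\<forall>x' \<in> Domain a. card (a `` {x'}) = n"
  then show "n = card (a `` {x})"
    using x by simp
qed

end


section \<open>Non-negative matrices, relations, and monoids\<close>

text \<open>A morphism from \<open>A\<close> to \<open>B\<close> in the category of non-negative real matrices is a function
  giving the entry at each \<open>x \<in> A\<close> and \<open>y \<in> B\<close>; only these entries count.
  The unit object is \<open>{()}\<close>.\<close>

type_synonym ('a, 'b) nn_matrix = "'a \<Rightarrow> 'b \<Rightarrow> real"

definition R_functor :: "'a set \<Rightarrow> 'b set \<Rightarrow> ('a, 'b) nn_matrix \<Rightarrow> ('a \<times> 'b) set" where
  "R_functor A B f = {(a, b). a \<in> A \<and> b \<in> B \<and> f a b > 0}"

definition nabla :: "'x set \<Rightarrow> ('x rel \<times> 'x rel, 'x rel) nn_matrix" where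
  "nabla X = (\<lambda>(a, b) c. real (nabla_number X a b c))"

definition unit_vector :: "'x set \<Rightarrow> (unit, 'x rel) nn_matrix" where
  "unit_vector X = (\<lambda>_ a. if a \<subseteq> Id_on X then 1 else 0)"

definition rel_tensor :: "('a \<times> 'b) set \<Rightarrow> ('c \<times> 'd) set \<Rightarrow> (('a \<times> 'c) \<times> ('b \<times> 'd)) set" where
  "rel_tensor r s = {((a, c), (b, d)). (a, b) \<in> r \<and> (c, d) \<in> s}"

text \<open>Monoid objects in the category of sets and relations. Relational composition \<open>O\<close> is
  diagrammatic; the associator and the unitors of the cartesian product are written out.\<close>

definition monoid_in_Rel ::
    "'m set \<Rightarrow> (('m \<times> 'm) \<times> 'm) set \<Rightarrow> (unit \<times> 'm) set \<Rightarrow> bool" where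
  "monoid_in_Rel M \<mu> \<eta> \<longleftrightarrow>
    \<mu> \<subseteq> (M \<times> M) \<times> M \<and> \<eta> \<subseteq> {()} \<times> M \<and>
    rel_tensor \<mu> (Id_on M) O \<mu> =
      {(((a, b), c), (a, (b, c))) | a b c. a \<in> M \<and> b \<in> M \<and> c \<in> M}
        O rel_tensor (Id_on M) \<mu> O \<mu> \<and>
    rel_tensor \<eta> (Id_on M) O \<mu> = {(((), a), a) | a. a \<in> M} \<and>
    rel_tensor (Id_on M) \<eta> O \<mu> = {((a, ()), a) | a. a \<in> M}"


section \<open>Groupoids\<close>

text \<open>Small categories with composition in diagrammatic order: \<open>Comp G f g\<close> is ``first \<open>f\<close>,
  then \<open>g\<close>'', and it is only meaningful if \<open>Cod G f = Dom G g\<close>. This is the order in which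
  the numbers above read \<open>a\<close> and \<open>b\<close>.\<close>

record ('o, 'm) small_category_data =
  Obj :: "'o set"
  Arr :: "'m set"
  Dom :: "'m \<Rightarrow> 'o"
  Cod :: "'m \<Rightarrow> 'o"
  Ident :: "'o \<Rightarrow> 'm"
  Comp :: "'m \<Rightarrow> 'm \<Rightarrow> 'm"

locale small_category =
  fixes G :: "('o, 'm) small_category_data"
  assumes Dom_in: "f \<in> Arr G \<Longrightarrow> Dom G f \<in> Obj G"
    and Cod_in: "f \<in> Arr G \<Longrightarrow> Cod G f \<in> Obj G"
    and Ident_in: "u \<in> Obj G \<Longrightarrow> Ident G u \<in> Arr G"
    and Dom_Ident: "u \<in> Obj G \<Longrightarrow> Dom G (Ident G u) = u"
    and Cod_Ident: "u \<in> Obj G \<Longrightarrow> Cod G (Ident G u) = u"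
    and Comp_in: "\<lbrakk>f \<in> Arr G; g \<in> Arr G; Cod G f = Dom G g\<rbrakk> \<Longrightarrow> Comp G f g \<in> Arr G"
    and Dom_Comp: "\<lbrakk>f \<in> Arr G; g \<in> Arr G; Cod G f = Dom G g\<rbrakk> \<Longrightarrow>
      Dom G (Comp G f g) = Dom G f"
    and Cod_Comp: "\<lbrakk>f \<in> Arr G; g \<in> Arr G; Cod G f = Dom G g\<rbrakk> \<Longrightarrow>
      Cod G (Comp G f g) = Cod G g"
    and Comp_assoc: "\<lbrakk>f \<in> Arr G; g \<in> Arr G; h \<in> Arr G;
      Cod G f = Dom G g; Cod G g = Dom G h\<rbrakk> \<Longrightarrow>
      Comp G (Comp G f g) h = Comp G f (Comp G g h)"
    and Ident_left: "f \<in> Arr G \<Longrightarrow> Comp G (Ident G (Dom G f)) f = f"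
    and Ident_right: "f \<in> Arr G \<Longrightarrow> Comp G f (Ident G (Cod G f)) = f"

locale groupoid = small_category G for G :: "('o, 'm) small_category_data" +
  assumes invertible: "f \<in> Arr G \<Longrightarrow>
    \<exists>g \<in> Arr G. Dom G g = Cod G f \<and> Cod G g = Dom G f \<and>
      Comp G f g = Ident G (Dom G f) \<and> Comp G g f = Ident G (Cod G f)"

definition Comp_rel :: "('o, 'm) small_category_data \<Rightarrow> (('m \<times> 'm) \<times> 'm) set" where
  "Comp_rel G = {((f, g), Comp G f g) | f g. f \<in> Arr G \<and> g \<in> Arr G \<and> Cod G f = Dom G g}"

definition Ident_rel :: "('o, 'm) small_category_data \<Rightarrow> (unit \<times> 'm) set" where
  "Ident_rel G = {((), Ident G u) | u. u \<in> Obj G}"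

text \<open>The objects of \<open>G\<close> are taken in the type of its arrows. This is no restriction, since every
  small category is isomorphic, identically on arrows, to one whose objects are its identity
  arrows.\<close>

definition is_groupoid_in_Rel ::
    "'m set \<Rightarrow> (('m \<times> 'm) \<times> 'm) set \<Rightarrow> (unit \<times> 'm) set \<Rightarrow> bool" where
  "is_groupoid_in_Rel M \<mu> \<eta> \<longleftrightarrow>
    (\<exists>G :: ('m, 'm) small_category_data.
      groupoid G \<and> Arr G = M \<and> Comp_rel G = \<mu> \<and> Ident_rel G = \<eta>)"

end

theory Submission imports Defs begin

text \<open>Coherence forces the domains of any two members of \<open>S\<close> to be equal or disjoint, and the
  diagonal of each such domain to be a member of \<open>S\<close>. If \<open>S\<close> is thin, its members are moreover
  graphs of bijections between these domains, so the relational composite of two composable members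
  is again a single member. Hence \<open>S\<close> is a groupoid under relational composition and converse, and
  a coefficient of \<open>\<nabla>\<close> at \<open>(a, b, c)\<close> is positive exactly if \<open>a\<close>, \<open>b\<close> are composable
  with composite \<open>c\<close>.\<close>

section \<open>Small categories as monoids in relations\<close>

text \<open>Both bracketings relate \<open>((f, g), h)\<close> to \<open>k\<close> exactly if
  consecutive arrows are composable and \<open>k\<close> is the threefold composite, since
  composition keeps the outer endpoints. Among identities, exactly the one at \<open>Dom G f\<close>
  composes with \<open>f\<close> on the left, and the one at \<open>Cod G f\<close> on the
  right.\<close>

lemma (in small_category) monoid_in_Rel_category:
  "monoid_in_Rel (Arr G) (Comp_rel G) (Ident_rel G)"
  unfolding monoid_in_Rel_def
proof (intro conjI)
  let ?M = "Arr G" and ?\<mu> = "Comp_rel G" and ?\<eta> = "Ident_rel G"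
  show "?\<mu> \<subseteq> (?M \<times> ?M) \<times> ?M"
    unfolding Comp_rel_def using Comp_in by auto
  show "?\<eta> \<subseteq> {()} \<times> ?M"
    unfolding Ident_rel_def using Ident_in by auto
  have \<mu>_iff: "((f, g), h) \<in> ?\<mu> \<longleftrightarrow>
      f \<in> ?M \<and> g \<in> ?M \<and> Cod G f = Dom G g \<and> h = Comp G f g" for f g h
    by (auto simp: Comp_rel_def)
  have \<eta>_iff: "(u, h) \<in> ?\<eta> \<longleftrightarrow> (\<exists>v \<in> Obj G. h = Ident G v)" for u h
    by (auto simp: Ident_rel_def)
  have l: "(((f, g), h), k) \<in> rel_tensor ?\<mu> (Id_on ?M) O ?\<mu> \<longleftrightarrow>
      (\<exists>m. ((f, g), m) \<in> ?\<mu> \<and> h \<in> ?M \<and> ((m, h), k) \<in> ?\<mu>)" for f g h k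
    by (auto simp: rel_tensor_def)
  have r: "(((f, g), h), k) \<in> {(((a, b), c), (a, (b, c))) | a b c. a \<in> ?M \<and> b \<in> ?M \<and> c \<in> ?M}
        O rel_tensor (Id_on ?M) ?\<mu> O ?\<mu> \<longleftrightarrow>
      (f \<in> ?M \<and> g \<in> ?M \<and> h \<in> ?M \<and> (\<exists>m. ((g, h), m) \<in> ?\<mu> \<and> ((f, m), k) \<in> ?\<mu>))" for f g h k
    by (auto simp: rel_tensor_def relcomp_unfold)
  have "(((f, g), h), k) \<in> rel_tensor ?\<mu> (Id_on ?M) O ?\<mu> \<longleftrightarrow>
      (((f, g), h), k) \<in> {(((a, b), c), (a, (b, c))) | a b c. a \<in> ?M \<and> b \<in> ?M \<and> c \<in> ?M}
        O rel_tensor (Id_on ?M) ?\<mu> O ?\<mu>" for f g h k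
    unfolding l r \<mu>_iff
    by (auto simp: Comp_in Dom_Comp Cod_Comp Comp_assoc)
  then show "rel_tensor ?\<mu> (Id_on ?M) O ?\<mu> =
      {(((a, b), c), (a, (b, c))) | a b c. a \<in> ?M \<and> b \<in> ?M \<and> c \<in> ?M}
        O rel_tensor (Id_on ?M) ?\<mu> O ?\<mu>"
    by (intro subset_antisym subrelI; simp only: split_paired_all)
  have "((u, f), k) \<in> rel_tensor ?\<eta> (Id_on ?M) O ?\<mu> \<longleftrightarrow>
      (\<exists>m. (u, m) \<in> ?\<eta> \<and> f \<in> ?M \<and> ((m, f), k) \<in> ?\<mu>)" for u f k
    by (auto simp: rel_tensor_def)
  then have "((u, f), k) \<in> rel_tensor ?\<eta> (Id_on ?M) O ?\<mu> \<longleftrightarrow> f \<in> ?M \<and> k = f" for u f k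
    unfolding \<mu>_iff \<eta>_iff
    using Ident_in Cod_Ident Ident_left Dom_in by metis
  then show "rel_tensor ?\<eta> (Id_on ?M) O ?\<mu> = {(((), a), a) | a. a \<in> ?M}"
    by auto
  have "((f, u), k) \<in> rel_tensor (Id_on ?M) ?\<eta> O ?\<mu> \<longleftrightarrow>
      (\<exists>m. (u, m) \<in> ?\<eta> \<and> f \<in> ?M \<and> ((f, m), k) \<in> ?\<mu>)" for u f k
    by (auto simp: rel_tensor_def)
  then have "((f, u), k) \<in> rel_tensor (Id_on ?M) ?\<eta> O ?\<mu> \<longleftrightarrow> f \<in> ?M \<and> k = f" for u f k
    unfolding \<mu>_iff \<eta>_iff
    using Ident_in Dom_Ident Ident_right Cod_in by metis
  then show "rel_tensor (Id_on ?M) ?\<eta> O ?\<mu> = {((a, ()), a) | a. a \<in> ?M}"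
    by auto
qed

section \<open>Relational products in a coherent configuration\<close>

context coherent_configuration
begin

lemma member_nonempty: "a \<in> S \<Longrightarrow> \<exists>x y. (x, y) \<in> a"
  using partition unfolding partition_on_def by (metis all_not_in_conv surj_pair)

lemma member_exists: "x \<in> X \<Longrightarrow> y \<in> X \<Longrightarrow> \<exists>a \<in> S. (x, y) \<in> a"
  using partition unfolding partition_on_def by blast

text \<open>A pair lies in \<open>a O b\<close> exactly if the number of intermediate points counted
  at it is nonzero, and coherence makes that number constant on \<open>c\<close>.\<close>

lemma relcomp_transfer:
  assumes "a \<in> S" "b \<in> S" "c \<in> S" "(x, y) \<in> c" "(x', y') \<in> c" "(x, y) \<in> a O b"
  shows "(x', y') \<in> a O b"
proof -
  have "{z \<in> X. (x, z) \<in> a \<and> (z, y) \<in> b} \<noteq> {}"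
    using assms(6) subset_points[OF assms(1)] by blast
  then have "card {z \<in> X. (x, z) \<in> a \<and> (z, y) \<in> b} \<noteq> 0"
    using finite_points by simp
  then have "card {z \<in> X. (x', z) \<in> a \<and> (z, y') \<in> b} \<noteq> 0"
    using coherent[OF assms(1-5)] by simp
  then have "{z \<in> X. (x', z) \<in> a \<and> (z, y') \<in> b} \<noteq> {}"
    by force
  then show ?thesis
    by blast
qed

lemma nabla_number_pos_iff:
  assumes "a \<in> S" "b \<in> S" "c \<in> S"
  shows "nabla_number X a b c > 0 \<longleftrightarrow> c \<subseteq> a O b"
proof -
  obtain x y where xy: "(x, y) \<in> c"
    using member_nonempty[OF assms(3)] by blast
  have "nabla_number X a b c > 0 \<longleftrightarrow> {z \<in> X. (x, z) \<in> a \<and> (z, y) \<in> b} \<noteq> {}"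
    using nabla_number_eq[OF assms xy] finite_points by (simp add: card_gt_0_iff)
  also have "\<dots> \<longleftrightarrow> (x, y) \<in> a O b"
    using subset_points[OF assms(1)] by blast
  also have "\<dots> \<longleftrightarrow> c \<subseteq> a O b"
    using relcomp_transfer[OF assms xy] xy by auto
  finally show ?thesis .
qed

text \<open>This lets the member through a single loop determine the whole of
  \<open>Domain a\<close>, and so fixes the source object of \<open>a\<close>.\<close>

lemma diagonal_eq_Domain:
  assumes a: "a \<in> S" and p: "p \<in> S" "(x, x) \<in> p" and x: "x \<in> Domain a"
  shows "p = Id_on (Domain a)"
proof -
  obtain y where xy: "(x, y) \<in> a"
    using x by blast
  have pId: "p \<subseteq> Id_on X"
    using diagonal[OF p] .
  \<comment> \<open>The pair \<open>(x, y)\<close> is in \<open>p O a\<close> through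
    \<open>x\<close> itself. After transfer to \<open>(u, v)\<close> the intermediate point must be
    \<open>u\<close>, because \<open>p\<close> is diagonal.\<close>
  have "(u, u) \<in> p" if "(u, v) \<in> a" for u v
    using relcomp_transfer[OF p(1) a a xy that] p(2) xy pId by auto
  \<comment> \<open>The pair \<open>(x, x)\<close> is in \<open>a O a\<inverse>\<close> through
    \<open>y\<close>; transfer to the loop at \<open>u\<close> supplies a successor of
    \<open>u\<close>.\<close>
  moreover have "u \<in> Domain a" if "(u, u) \<in> p" for u
    using relcomp_transfer[OF a converse_closed[OF a] p that] xy by blast
  ultimately show ?thesis
    using pId by (auto simp: Id_on_def)
qed

lemma Id_on_Domain_in:
  assumes a: "a \<in> S"
  shows "Id_on (Domain a) \<in> S"
proof -
  obtain x y where xy: "(x, y) \<in> a"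
    using member_nonempty[OF a] by blast
  then obtain p where "p \<in> S" "(x, x) \<in> p"
    using member_exists subset_points[OF a] by blast
  then show ?thesis
    using diagonal_eq_Domain[OF a, of p x] xy by auto
qed

lemma Id_on_Range_in: "a \<in> S \<Longrightarrow> Id_on (Range a) \<in> S"
  using Id_on_Domain_in[OF converse_closed] by simp

text \<open>The diagonal of \<open>Domain a\<close> is a member with a loop at \<open>x\<close>, so
  \<open>diagonal_eq_Domain\<close> for \<open>b\<close> makes it the diagonal of
  \<open>Domain b\<close> as well.\<close>

lemma Domain_eq:
  assumes "a \<in> S" "b \<in> S" "x \<in> Domain a" "x \<in> Domain b"
  shows "Domain a = Domain b"
  using diagonal_eq_Domain[OF assms(2) Id_on_Domain_in[OF assms(1)] _ assms(4)] assms(3)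
  by (metis Domain_Id_on Id_onI)

lemma Range_eq_Domain:
  assumes "a \<in> S" "b \<in> S" "x \<in> Range a" "x \<in> Domain b"
  shows "Range a = Domain b"
  using Domain_eq[OF converse_closed] assms by simp

end

section \<open>Thin configurations: members as bijections\<close>

locale thin_configuration = coherent_configuration +
  assumes thin: "thin S"
begin

lemma single_valued_member:
  assumes "a \<in> S"
  shows "single_valued a"
proof (rule single_valuedI)
  fix x y z assume xy: "(x, y) \<in> a" and xz: "(x, z) \<in> a"
  then have "x \<in> Domain a"
    by blast
  then have "card (a `` {x}) = 1"
    using valency_eq[OF assms] thin assms by (simp add: thin_def)
  then obtain w where "a `` {x} = {w}"
    by (auto simp: card_1_singleton_iff)
  moreover have "y \<in> a `` {x}" "z \<in> a `` {x}"
    using xy xz by simp_all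
  ultimately show "y = z"
    by simp
qed

text \<open>Thinness counts successors; predecessors are successors under the converse, which is a
  member too.\<close>

lemma injective_member: "\<lbrakk>a \<in> S; (x, y) \<in> a; (x', y) \<in> a\<rbrakk> \<Longrightarrow> x = x'"
  using single_valued_member[OF converse_closed] by (auto dest: single_valuedD)

text \<open>Transfer from \<open>q\<close> puts \<open>c\<close> inside \<open>a O b\<close>. Every
  source of \<open>a O b\<close> lies in \<open>Domain a = Domain c\<close>, and
  \<open>a O b\<close> is single-valued, so no pair is left outside \<open>c\<close>.\<close>

lemma relcomp_eq:
  assumes a: "a \<in> S" and b: "b \<in> S" and c: "c \<in> S" and q: "q \<in> c" "q \<in> a O b"
  shows "a O b = c"
proof
  obtain x y z where xyz: "q = (x, z)" "(x, y) \<in> a" "(y, z) \<in> b"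
    using q(2) by blast
  then have "Domain a = Domain c"
    using Domain_eq[OF a c] q(1) by blast
  have ab: "c \<subseteq> a O b"
    using relcomp_transfer[OF a b c, of x z] q by (intro subrelI) (simp only: xyz(1))
  then show "c \<subseteq> a O b" .
  show "a O b \<subseteq> c"
  proof (rule subrelI)
    fix u v assume uv: "(u, v) \<in> a O b"
    then have "u \<in> Domain c"
      using \<open>Domain a = Domain c\<close> by blast
    then obtain w where w: "(u, w) \<in> c"
      by blast
    moreover have "v = w"
      using single_valuedD[OF single_valued_relcomp uv subsetD[OF ab w]]
        single_valued_member[OF a] single_valued_member[OF b] by simp
    ultimately show "(u, v) \<in> c"
      by simp
  qed
qed

lemma relcomp_in:
  assumes a: "a \<in> S" and b: "b \<in> S" and ab: "Range a = Domain b"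
  shows "a O b \<in> S"
proof -
  obtain x y where xy: "(x, y) \<in> a"
    using member_nonempty[OF a] by blast
  \<comment> \<open>Matching range and domain yields one pair of the composite; the member through
    that pair is the whole composite by \<open>relcomp_eq\<close>.\<close>
  then obtain z where yz: "(y, z) \<in> b"
    using ab by blast
  then obtain c where c: "c \<in> S" "(x, z) \<in> c"
    using member_exists subset_points[OF a] subset_points[OF b] xy by blast
  then have "a O b = c"
    using relcomp_eq[OF a b c] xy yz by blast
  then show ?thesis
    using c by simp
qed

lemma relcomp_converse_member: "a \<in> S \<Longrightarrow> a O a\<inverse> = Id_on (Domain a)"
  by (auto simp: Id_on_iff dest: injective_member)

lemma converse_relcomp_member: "a \<in> S \<Longrightarrow> a\<inverse> O a = Id_on (Range a)"
  using relcomp_converse_member[OF converse_closed] by simp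

text \<open>Since \<open>c\<close> is nonempty, \<open>c \<subseteq> a O b\<close> makes
  \<open>Range a\<close> meet \<open>Domain b\<close>, and such sets are equal once they meet. The
  inclusion itself becomes an equality by \<open>relcomp_eq\<close>.\<close>

lemma nabla_number_pos_iff_composite:
  assumes "a \<in> S" "b \<in> S" "c \<in> S"
  shows "nabla_number X a b c > 0 \<longleftrightarrow> Range a = Domain b \<and> c = a O b"
proof -
  obtain q where q: "q \<in> c"
    using member_nonempty[OF assms(3)] by blast
  have "Range a = Domain b \<and> c = a O b" if ab: "c \<subseteq> a O b"
  proof
    obtain y where "y \<in> Range a" "y \<in> Domain b"
      using q ab by blast
    then show "Range a = Domain b"
      using Range_eq_Domain[OF assms(1,2)] by blast
    show "c = a O b"
      using relcomp_eq[OF assms q] q ab by blast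
  qed
  then show ?thesis
    using nabla_number_pos_iff[OF assms] by blast
qed

section \<open>The groupoid and its two relations\<close>

text \<open>Taking the diagonal members themselves as objects makes the identity arrows literally
  the members selected by the unit.\<close>

definition configuration_groupoid :: "('a rel, 'a rel) small_category_data" where
  "configuration_groupoid = \<lparr>Obj = {a \<in> S. a \<subseteq> Id_on X}, Arr = S,
    Dom = (\<lambda>a. Id_on (Domain a)), Cod = (\<lambda>a. Id_on (Range a)),
    Ident = (\<lambda>a. a), Comp = (O)\<rparr>"

lemma configuration_groupoid_sel [simp]:
  "Obj configuration_groupoid = {a \<in> S. a \<subseteq> Id_on X}"
  "Arr configuration_groupoid = S"
  "Dom configuration_groupoid a = Id_on (Domain a)"
  "Cod configuration_groupoid a = Id_on (Range a)"
  "Ident configuration_groupoid a = a"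
  "Comp configuration_groupoid a b = a O b"
  by (simp_all add: configuration_groupoid_def)

lemma Id_on_eq_iff: "Id_on A = Id_on B \<longleftrightarrow> A = B"
  by (metis Domain_Id_on)

lemma groupoid_configuration: "groupoid configuration_groupoid"
\<comment> \<open>Cases 1 to 11 follow the order of the axioms of \<open>small_category\<close>;
  case 12 is \<open>invertible\<close>.\<close>
proof (unfold_locales, goal_cases)
  case (1 f) then show ?case by (auto simp: Id_on_Domain_in dest: subset_points)
next
  case (2 f) then show ?case by (auto simp: Id_on_Range_in dest: subset_points)
next
  case (3 u) then show ?case by simp
next
  case (4 u) then show ?case by auto
next
  case (5 u) then show ?case by auto
next
  case (6 f g) then show ?case using relcomp_in by (simp add: Id_on_eq_iff)
next
  case (7 f g)
  then have "Range f = Domain g" by (simp add: Id_on_eq_iff)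
  then have "Domain (f O g) = Domain f" by blast
  then show ?case by simp
next
  case (8 f g)
  then have "Range f = Domain g" by (simp add: Id_on_eq_iff)
  then have "Range (f O g) = Range g" by blast
  then show ?case by simp
next
  case (9 f g h) then show ?case by (simp add: O_assoc)
next
  case (10 f) then show ?case by auto
next
  case (11 f) then show ?case by auto
next
  case (12 f)
  then show ?case
    by (intro bexI[of _ "f\<inverse>"])
      (simp_all add: relcomp_converse_member converse_relcomp_member converse_closed)
qed

lemma Comp_rel_configuration:
  "Comp_rel configuration_groupoid = R_functor (S \<times> S) S (nabla X)"
proof (rule subset_antisym; rule subsetI)
  fix t assume "t \<in> Comp_rel configuration_groupoid"
  then obtain a b where t: "t = ((a, b), a O b)" "a \<in> S" "b \<in> S" "Range a = Domain b"
    by (auto simp: Comp_rel_def Id_on_eq_iff)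
  then show "t \<in> R_functor (S \<times> S) S (nabla X)"
    using nabla_number_pos_iff_composite relcomp_in by (simp add: R_functor_def nabla_def)
next
  fix t assume "t \<in> R_functor (S \<times> S) S (nabla X)"
  then obtain a b c where "t = ((a, b), c)" "a \<in> S" "b \<in> S" "c \<in> S" "nabla_number X a b c > 0"
    by (auto simp: R_functor_def nabla_def)
  then show "t \<in> Comp_rel configuration_groupoid"
    using nabla_number_pos_iff_composite by (auto simp: Comp_rel_def)
qed

lemma Ident_rel_configuration:
  "Ident_rel configuration_groupoid = R_functor {()} S (unit_vector X)"
  by (auto simp: Ident_rel_def R_functor_def unit_vector_def split: if_splits)

end

theorem corollary6p5:
  fixes X :: "'x set" and S :: "'x rel set"
  assumes "coherent_configuration X S"
    and "thin S"
  shows "monoid_in_Rel S (R_functor (S \<times> S) S (nabla X)) (R_functor {()} S (unit_vector X)) \<and>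
    is_groupoid_in_Rel S (R_functor (S \<times> S) S (nabla X)) (R_functor {()} S (unit_vector X))"
proof -
  interpret thin_configuration X S
    using assms by (simp add: thin_configuration_def thin_configuration_axioms_def)
  \<comment> \<open>The monoid laws come from the category just built, whose composition and
    identity relations are the two images under \<open>R_functor\<close>.\<close>
  interpret groupoid configuration_groupoid
    by (rule groupoid_configuration)
  show ?thesis
    using monoid_in_Rel_category groupoid_configuration
      Comp_rel_configuration Ident_rel_configuration
    unfolding is_groupoid_in_Rel_def by auto
qed

end
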